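(* In the downlink PD-NOMA model of the context (one subcarrier, $K=1$), assume $a_m>\varepsilon_m a_n$ and $a_n>\varepsilon_n a_m$. Consider the connection outage probability of the $n$-th user for the alternative formulation (ALF), $P_{n2}(\rho)=\Pr\{\gamma_{n\to m}\le\varepsilon_m,\ \gamma_{n\to n}\le\varepsilon_n\}+\Pr\{\gamma_{n\to m}>\varepsilon_m,\ \gamma_n\le\varepsilon_n\}$. Its diversity order is $0$ with imperfect SIC ($\varpi=1$) and $n$ with perfect SIC ($\varpi=0$).
   Context: Fix integers $M\ge2$ and $1\le m<n\le M$, reals $\eta,\alpha,R_D,\Omega_I>0$, power coefficients $a_m>a_n>0$ with $a_m+a_n=1$, and target rates $R_m,R_n>0$ with $\varepsilon_m=2^{R_m}-1$, $\varepsilon_n=2^{R_n}-1$; $\rho>0$ is the transmit SNR. $M$ users are placed independently and uniformly in a disc of radius $R_D$ centred at the base station. A user at distance $d$ from the centre has channel coefficient $\sqrt{\eta}\,h/\sqrt{1+d^\alpha}$ with $h\sim\mathcal{CN}(0,1)$ (circularly symmetric, $\mathbb{E}|h|^2=1$), independent across users and of the locations. Users are relabelled so that their squared channel moduli satisfy $Z_1<\dots<Z_M$. The residual interference coefficient $h_I\sim\mathcal{CN}(0,\Omega_I)$ is independent of everything else, and $Y_I=|h_I|^2$. SINRs: $\gamma_{n\to m}=\frac{\rho Z_n a_m}{\rho Z_n a_n+1}$, $\gamma_n=\frac{\rho Z_n a_n}{\varpi\rho Y_I+1}$, $\gamma_{n\to n}=\frac{\rho Z_n a_n}{\rho Z_n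 a_m+1}$. Diversity order of an outage probability $P(\rho)$: $d=-\lim_{\rho\to\infty}\frac{\log P^\infty(\rho)}{\log\rho}$, where $P^\infty$ is the asymptotic outage probability at high SNR, i.e. $P(\rho)/P^\infty(\rho)\to1$ as $\rho\to\infty$. *)

theory Defs
  imports "HOL-Probability.Probability"
begin

text \<open>Density (w.r.t. Lebesgue measure on the plane) of the circularly symmetric complex normal
  law with mean 0 and \<open>E |h|\<^sup>2 = v\<close>, for \<open>v > 0\<close>.\<close>
definition cn_density :: "real \<Rightarrow> complex \<Rightarrow> real" where
  "cn_density v z = exp (- (cmod z)\<^sup>2 / v) / (pi * v)"

text \<open>The base station sits at the origin of the plane.\<close>
definition disc_density :: "real \<Rightarrow> complex \<Rightarrow> real" where
  "disc_density r z = indicator (cball 0 r) z / measure lborel (cball (0::complex) r)"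

text \<open>Index type for the sources of randomness, used to state their joint independence.
  Users carry their labels before ordering here.\<close>
datatype source = Location nat | Fading nat | Residual

definition channel :: "real \<Rightarrow> real \<Rightarrow> complex \<Rightarrow> complex \<Rightarrow> complex" where
  "channel \<eta> \<alpha> x h =
     complex_of_real (sqrt \<eta>) * h / complex_of_real (sqrt (1 + cmod x powr \<alpha>))"

text \<open>The \<open>k\<close>-th smallest (\<open>1 \<le> k \<le> M\<close>) squared channel modulus among the users \<open>1, \<dots>, M\<close>.
  Ties occur only on a null set in the model considered.\<close>
definition ordered_gain ::
    "real \<Rightarrow> real \<Rightarrow> nat \<Rightarrow> (nat \<Rightarrow> 'w \<Rightarrow> complex) \<Rightarrow> (nat \<Rightarrow> 'w \<Rightarrow> complex) \<Rightarrow> nat \<Rightarrow> 'w \<Rightarrow> real" where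
  "ordered_gain \<eta> \<alpha> M loc h k \<omega> =
     sort (map (\<lambda>i. (cmod (channel \<eta> \<alpha> (loc i \<omega>) (h i \<omega>)))\<^sup>2) [1..<Suc M]) ! (k - 1)"

text \<open>In the SINRs, \<open>z\<close> is the ordered gain of user \<open>n\<close>, \<open>y\<close> the residual interference gain and
  \<open>varpi\<close> the SIC indicator (1 imperfect, 0 perfect).\<close>

definition sinr_n_to_m :: "real \<Rightarrow> real \<Rightarrow> real \<Rightarrow> real \<Rightarrow> real" where
  "sinr_n_to_m am an \<rho> z = \<rho> * z * am / (\<rho> * z * an + 1)"

definition sinr_n :: "real \<Rightarrow> real \<Rightarrow> real \<Rightarrow> real \<Rightarrow> real \<Rightarrow> real" where
  "sinr_n varpi an \<rho> z y = \<rho> * z * an / (varpi * \<rho> * y + 1)"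

definition sinr_n_to_n :: "real \<Rightarrow> real \<Rightarrow> real \<Rightarrow> real \<Rightarrow> real" where
  "sinr_n_to_n am an \<rho> z = \<rho> * z * an / (\<rho> * z * am + 1)"

definition sinr_threshold :: "real \<Rightarrow> real" where
  "sinr_threshold r = 2 powr r - 1"

definition outage_ALF ::
    "'w measure \<Rightarrow> ('w \<Rightarrow> real) \<Rightarrow> ('w \<Rightarrow> real) \<Rightarrow> real \<Rightarrow> real \<Rightarrow> real \<Rightarrow> real \<Rightarrow> real \<Rightarrow> real \<Rightarrow> real" where
  "outage_ALF W Z Y varpi am an \<epsilon>m \<epsilon>n \<rho> =
     measure W {\<omega> \<in> space W. sinr_n_to_m am an \<rho> (Z \<omega>) \<le> \<epsilon>m \<and>
                              sinr_n_to_n am an \<rho> (Z \<omega>) \<le> \<epsilon>n} +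
     measure W {\<omega> \<in> space W. sinr_n_to_m am an \<rho> (Z \<omega>) > \<epsilon>m \<and>
                              sinr_n varpi an \<rho> (Z \<omega>) (Y \<omega>) \<le> \<epsilon>n}"

definition asymptotic_outage :: "(real \<Rightarrow> real) \<Rightarrow> (real \<Rightarrow> real) \<Rightarrow> bool" where
  "asymptotic_outage P P_inf \<longleftrightarrow> ((\<lambda>\<rho>. P \<rho> / P_inf \<rho>) \<longlongrightarrow> 1) at_top"

text \<open>\<open>P_inf\<close> is determined by \<open>P\<close> only up to asymptotic equivalence, so the limit is required for
  every choice; the first conjunct excludes a vacuous reading.\<close>
definition has_diversity_order :: "(real \<Rightarrow> real) \<Rightarrow> real \<Rightarrow> bool" where
  "has_diversity_order P d \<longleftrightarrow>
     (\<exists>P_inf. asymptotic_outage P P_inf) \<and>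
     (\<forall>P_inf. asymptotic_outage P P_inf \<longrightarrow>
        ((\<lambda>\<rho>. - (ln (P_inf \<rho>) / ln \<rho>)) \<longlongrightarrow> d) at_top)"

end

theory Submission
  imports Defs
begin

text \<open>Both SINR conditions on the ordered gain \<open>Z\<close> are linear, so with perfect SIC the outage
  probability lies between \<open>Pr (Z \<le> c / \<rho>)\<close> and \<open>2 Pr (Z \<le> C / \<rho>)\<close>. Locations are bounded, so each
  unordered gain is, up to constant factors, an exponential variable, and the event that \<open>n\<close> of
  \<open>M\<close> independent ones are at most \<open>x\<close> has probability of order \<open>x\<^sup>n\<close>.
  With imperfect SIC the residual interference also scales with \<open>\<rho>\<close>: once \<open>\<rho>\<close> is large, outage
  contains an event of positive probability that does not depend on \<open>\<rho>\<close>.\<close>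

section \<open>Diversity order from two-sided power-law bounds\<close>

text \<open>After taking logarithms and dividing by \<open>ln \<rho>\<close>, the constants
  contribute only \<open>ln c / ln \<rho>\<close> and \<open>ln C / ln \<rho>\<close>, which vanish
  in the limit. Orders of magnitude therefore suffice, and no exact asymptotic expansion of the
  outage probability has to be computed.\<close>

lemma has_diversity_orderI:
  fixes P :: "real \<Rightarrow> real"
  assumes "c > 0"
    and lower: "\<forall>\<^sub>F \<rho> in at_top. c * \<rho> powr (-d) \<le> P \<rho>"
    and upper: "\<forall>\<^sub>F \<rho> in at_top. P \<rho> \<le> C * \<rho> powr (-d)"
  shows "has_diversity_order P d"
proof -
  have P_pos: "\<forall>\<^sub>F \<rho> in at_top. P \<rho> > 0"
    using lower eventually_gt_at_top[of 0]
  proof eventually_elim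
    case (elim \<rho>)
    then have "0 < c * \<rho> powr (-d)" using \<open>c > 0\<close> by simp
    with elim show ?case by linarith
  qed
  \<comment> \<open>The sign of \<open>C\<close> is forced, since
    \<open>C * \<rho> powr (-d)\<close> dominates a positive function; \<open>ln C\<close> is then
    meaningful.\<close>
  have "\<forall>\<^sub>F \<rho> in at_top. 0 < C * (\<rho>::real) powr (-d)"
    using P_pos upper by eventually_elim linarith
  then have "\<exists>\<rho>::real. 0 < C * \<rho> powr (-d)"
    by (rule eventually_happens'[OF trivial_limit_at_top_linorder])
  then have "C > 0" by (auto simp: zero_less_mult_iff)
  have ln_inv: "((\<lambda>\<rho>::real. K / ln \<rho>) \<longlongrightarrow> 0) at_top" for K
    by (intro tendsto_divide_0[OF tendsto_const] filterlim_at_top_imp_at_infinity ln_at_top)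
  have lnP: "((\<lambda>\<rho>. ln (P \<rho>) / ln \<rho>) \<longlongrightarrow> - d) at_top"
  proof (rule real_tendsto_sandwich)
    show "\<forall>\<^sub>F \<rho> in at_top. ln c / ln \<rho> - d \<le> ln (P \<rho>) / ln \<rho>"
      using lower P_pos eventually_gt_at_top[of 1]
    proof eventually_elim
      case (elim \<rho>)
      have "ln c + - d * ln \<rho> = ln (c * \<rho> powr (-d))"
        using \<open>c > 0\<close> elim by (simp add: ln_mult ln_powr)
      also have "\<dots> \<le> ln (P \<rho>)" using elim \<open>c > 0\<close> by (subst ln_le_cancel_iff) auto
      finally have "(ln c + - d * ln \<rho>) / ln \<rho> \<le> ln (P \<rho>) / ln \<rho>"
        using elim by (intro divide_right_mono) auto
      then show ?case using elim by (simp add: diff_divide_distrib)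
    qed
    show "\<forall>\<^sub>F \<rho> in at_top. ln (P \<rho>) / ln \<rho> \<le> ln C / ln \<rho> - d"
      using upper P_pos eventually_gt_at_top[of 1]
    proof eventually_elim
      case (elim \<rho>)
      have "ln (P \<rho>) \<le> ln (C * \<rho> powr (-d))"
        using elim \<open>C > 0\<close> by (subst ln_le_cancel_iff) auto
      also have "\<dots> = ln C + - d * ln \<rho>"
        using \<open>C > 0\<close> elim by (simp add: ln_mult ln_powr)
      finally have "ln (P \<rho>) / ln \<rho> \<le> (ln C + - d * ln \<rho>) / ln \<rho>"
        using elim by (intro divide_right_mono) auto
      then show ?case using elim by (simp add: diff_divide_distrib)
    qed
    show "((\<lambda>\<rho>. ln c / ln \<rho> - d) \<longlongrightarrow> - d) at_top"
      using tendsto_diff[OF ln_inv tendsto_const] by simp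
    show "((\<lambda>\<rho>. ln C / ln \<rho> - d) \<longlongrightarrow> - d) at_top"
      using tendsto_diff[OF ln_inv tendsto_const] by simp
  qed
  \<comment> \<open>Being eventually nonzero, \<open>P\<close> is its own asymptotic representative,
    which settles the existence conjunct.\<close>
  have "asymptotic_outage P P"
    unfolding asymptotic_outage_def
    by (rule tendsto_eventually, rule eventually_mono[OF P_pos]) simp
  moreover have "((\<lambda>\<rho>. - (ln (Q \<rho>) / ln \<rho>)) \<longlongrightarrow> d) at_top" if "asymptotic_outage P Q" for Q
  proof -
    have ratio: "((\<lambda>\<rho>. P \<rho> / Q \<rho>) \<longlongrightarrow> 1) at_top"
      using that by (simp add: asymptotic_outage_def)
    \<comment> \<open>The numerator tends to \<open>ln 1 = 0\<close>, so replacing \<open>P\<close>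
      by any equivalent \<open>Q\<close> leaves the logarithmic rate unchanged.\<close>
    have "((\<lambda>\<rho>. ln (P \<rho> / Q \<rho>) / ln \<rho>) \<longlongrightarrow> 0) at_top"
      using ratio
      by (intro tendsto_divide_0[OF tendsto_ln] filterlim_at_top_imp_at_infinity ln_at_top) auto
    then have "((\<lambda>\<rho>. ln (P \<rho> / Q \<rho>) / ln \<rho> - ln (P \<rho>) / ln \<rho>) \<longlongrightarrow> d) at_top"
      using tendsto_diff[OF _ lnP] by fastforce
    moreover have "\<forall>\<^sub>F \<rho> in at_top.
        ln (P \<rho> / Q \<rho>) / ln \<rho> - ln (P \<rho>) / ln \<rho> = - (ln (Q \<rho>) / ln \<rho>)"
      using P_pos order_tendstoD(1)[OF ratio zero_less_one]
    proof eventually_elim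
      case (elim \<rho>)
      then have "Q \<rho> > 0" by (simp add: zero_less_divide_iff)
      with elim show ?case by (simp add: ln_div diff_divide_distrib)
    qed
    ultimately show ?thesis by (rule Lim_transform_eventually)
  qed
  ultimately show ?thesis by (auto simp: has_diversity_order_def)
qed

section \<open>Order statistics and channel gains\<close>

text \<open>In a sorted list the entries at most \<open>x\<close> occupy an initial segment. Indices
  start at zero, so position \<open>k\<close> lies in that segment exactly when its length exceeds
  \<open>k\<close>.\<close>

lemma sorted_nth_le_iff:
  fixes xs :: "'a :: linorder list"
  assumes "sorted xs" "k < length xs"
  shows "xs ! k \<le> x \<longleftrightarrow> k < length (filter (\<lambda>y. y \<le> x) xs)"
proof
  assume "xs ! k \<le> x"
  then have "{..k} \<subseteq> {i. i < length xs \<and> xs ! i \<le> x}"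
    using assms by (auto intro: order_trans[OF sorted_nth_mono])
  from card_mono[OF _ this] show "k < length (filter (\<lambda>y. y \<le> x) xs)"
    by (simp add: length_filter_conv_card)
next
  assume less: "k < length (filter (\<lambda>y. y \<le> x) xs)"
  show "xs ! k \<le> x"
  proof (rule ccontr)
    assume "\<not> xs ! k \<le> x"
    then have "{i. i < length xs \<and> xs ! i \<le> x} \<subseteq> {..<k}"
      using assms by (auto simp: not_le) (meson leI le_less_trans not_less sorted_nth_mono)
    from card_mono[OF _ this] less show False
      by (simp add: length_filter_conv_card)
  qed
qed

abbreviation gain :: "real \<Rightarrow> real \<Rightarrow> complex \<Rightarrow> complex \<Rightarrow> real" where
  "gain \<eta> \<alpha> x h \<equiv> (cmod (channel \<eta> \<alpha> x h))\<^sup>2"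

lemma gain_eq: "\<eta> \<ge> 0 \<Longrightarrow> gain \<eta> \<alpha> x h = \<eta> * (cmod h)\<^sup>2 / (1 + cmod x powr \<alpha>)"
  by (simp add: channel_def norm_mult norm_divide power_mult_distrib power_divide abs_of_nonneg)

text \<open>The path loss denominator is at least 1. Together with the next bound this removes the
  locations from all probability estimates, at the cost of constant factors.\<close>

lemma gain_le:
  assumes "\<eta> \<ge> 0" shows "gain \<eta> \<alpha> x h \<le> \<eta> * (cmod h)\<^sup>2"
proof -
  have "\<eta> * (cmod h)\<^sup>2 / (1 + cmod x powr \<alpha>) \<le> \<eta> * (cmod h)\<^sup>2 / 1"
    using assms by (intro divide_left_mono) (auto simp: add_pos_nonneg)
  then show ?thesis using assms by (simp add: gain_eq)
qed

text \<open>For a positive exponent the path loss denominator is largest at the rim of the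
  disc.\<close>

lemma gain_ge:
  assumes "\<eta> \<ge> 0" "\<alpha> \<ge> 0" "cmod x \<le> r"
  shows "\<eta> * (cmod h)\<^sup>2 / (1 + r powr \<alpha>) \<le> gain \<eta> \<alpha> x h"
proof -
  have "cmod x powr \<alpha> \<le> r powr \<alpha>" using assms by (intro powr_mono2) auto
  then have "\<eta> * (cmod h)\<^sup>2 / (1 + r powr \<alpha>) \<le> \<eta> * (cmod h)\<^sup>2 / (1 + cmod x powr \<alpha>)"
    using assms by (intro divide_left_mono) (auto intro!: mult_pos_pos add_pos_nonneg)
  then show ?thesis using assms by (simp add: gain_eq)
qed

text \<open>This trades sorting for counting, which independence can handle. Equal gains are counted
  with multiplicity, so ties need no separate treatment.\<close>

lemma ordered_gain_le_iff:
  assumes "1 \<le> k" "k \<le> M"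
  shows "ordered_gain \<eta> \<alpha> M loc h k \<omega> \<le> x \<longleftrightarrow>
    k \<le> card {i \<in> {1..M}. gain \<eta> \<alpha> (loc i \<omega>) (h i \<omega>) \<le> x}"
proof -
  let ?g = "\<lambda>i. gain \<eta> \<alpha> (loc i \<omega>) (h i \<omega>)"
  let ?xs = "map ?g [1..<Suc M]"
  have "length (filter (\<lambda>y. y \<le> x) (sort ?xs)) = length (filter (\<lambda>i. ?g i \<le> x) [1..<Suc M])"
    by (simp add: filter_sort filter_map comp_def del: upt_Suc)
  also have "\<dots> = card (set (filter (\<lambda>i. ?g i \<le> x) [1..<Suc M]))"
    by (rule distinct_card[symmetric]) simp
  also have "set (filter (\<lambda>i. ?g i \<le> x) [1..<Suc M]) = {i \<in> {1..M}. ?g i \<le> x}"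
    by auto
  finally have len: "length (filter (\<lambda>y. y \<le> x) (sort ?xs)) = card {i \<in> {1..M}. ?g i \<le> x}" .
  have "sort ?xs ! (k - 1) \<le> x \<longleftrightarrow> k - 1 < length (filter (\<lambda>y. y \<le> x) (sort ?xs))"
    using assms by (intro sorted_nth_le_iff) (auto simp del: upt_Suc)
  with assms show ?thesis unfolding ordered_gain_def len by linarith
qed

lemma ordered_gain_in_range:
  assumes "1 \<le> k" "k \<le> M"
  shows "\<exists>i\<in>{1..M}. ordered_gain \<eta> \<alpha> M loc h k \<omega> = gain \<eta> \<alpha> (loc i \<omega>) (h i \<omega>)"
proof -
  let ?xs = "map (\<lambda>i. gain \<eta> \<alpha> (loc i \<omega>) (h i \<omega>)) [1..<Suc M]"
  have "sort ?xs ! (k - 1) \<in> set (sort ?xs)"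
    using assms by (intro nth_mem) (auto simp del: upt_Suc)
  then show ?thesis unfolding ordered_gain_def by (auto simp del: upt_Suc)
qed

section \<open>Outage conditions as linear inequalities\<close>

text \<open>Clearing the positive denominator collects the gain on one side. Under the power
  allocation condition its coefficient \<open>am - \<epsilon> * an\<close> is positive, so the event
  becomes an upper bound on \<open>z\<close> of order \<open>1 / \<rho>\<close>.\<close>

lemma sinr_n_to_m_le_iff:
  assumes "an \<ge> 0" "\<rho> \<ge> 0" "z \<ge> 0"
  shows "sinr_n_to_m am an \<rho> z \<le> \<epsilon> \<longleftrightarrow> \<rho> * z * (am - \<epsilon> * an) \<le> \<epsilon>"
proof -
  have "\<rho> * z * an + 1 > 0" using assms by (simp add: add_nonneg_pos)
  then show ?thesis by (simp add: sinr_n_to_m_def pos_divide_le_eq algebra_simps)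
qed

lemma sinr_n_to_n_le_iff:
  assumes "am \<ge> 0" "\<rho> \<ge> 0" "z \<ge> 0"
  shows "sinr_n_to_n am an \<rho> z \<le> \<epsilon> \<longleftrightarrow> \<rho> * z * (an - \<epsilon> * am) \<le> \<epsilon>"
proof -
  have "\<rho> * z * am + 1 > 0" using assms by (simp add: add_nonneg_pos)
  then show ?thesis by (simp add: sinr_n_to_n_def pos_divide_le_eq algebra_simps)
qed

lemma sinr_n_le_iff:
  assumes "varpi \<ge> 0" "\<rho> \<ge> 0" "y \<ge> 0"
  shows "sinr_n varpi an \<rho> z y \<le> \<epsilon> \<longleftrightarrow> \<rho> * z * an \<le> \<epsilon> * (varpi * \<rho> * y + 1)"
proof -
  have "varpi * \<rho> * y + 1 > 0" using assms by (simp add: add_nonneg_pos)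
  then show ?thesis by (simp add: sinr_n_def pos_divide_le_eq algebra_simps)
qed

section \<open>Probabilities under the location and fading densities\<close>

lemma emeasure_lborel_open_pos:
  fixes U :: "'a :: euclidean_space set"
  assumes "open U" "U \<noteq> {}"
  shows "emeasure lborel U > 0"
proof -
  have "U \<notin> null_sets lborel"
    using open_not_negligible[OF assms] null_sets_completionI
    by (auto simp: negligible_iff_null_sets)
  then show ?thesis using assms by (auto simp: null_sets_def zero_less_iff_neq_zero)
qed

text \<open>Probability zero would make the density vanish almost everywhere on \<open>U\<close>. As
  it is positive there, \<open>U\<close> would be a Lebesgue null set, which no nonempty open set
  is.\<close>

lemma (in prob_space) distributed_prob_open_pos:
  fixes X :: "'a \<Rightarrow> 'b :: euclidean_space"
  assumes X: "distributed M lborel X f"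
    and U: "open U" "U \<noteq> {}" "\<And>x. x \<in> U \<Longrightarrow> f x > 0"
  shows "prob (X -` U \<inter> space M) > 0"
proof (rule ccontr)
  assume "\<not> ?thesis"
  then have "emeasure M (X -` U \<inter> space M) = 0"
    by (simp add: emeasure_eq_measure not_less measure_le_0_iff)
  then have "(\<integral>\<^sup>+x. f x * indicator U x \<partial>lborel) = 0"
    using U by (subst distributed_emeasure[OF X, symmetric]) auto
  then have "AE x in lborel. f x * indicator U x = 0"
    using distributed_borel_measurable[OF X] U
    by (subst (asm) nn_integral_0_iff_AE) auto
  then have "AE x in lborel. x \<notin> U"
    by eventually_elim (use U(3) in \<open>fastforce simp: indicator_def\<close>)
  then have "emeasure lborel U = 0"
    using U by (subst (asm) AE_iff_measurable[where N=U]) auto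
  with emeasure_lborel_open_pos[OF U(1,2)] show False by simp
qed

lemma cn_density_pos: "v > 0 \<Longrightarrow> cn_density v z > 0"
  by (simp add: cn_density_def)

lemma (in prob_space) distributed_disc_AE_le:
  assumes "distributed M lborel X (\<lambda>z. ennreal (disc_density r z))"
  shows "AE \<omega> in M. cmod (X \<omega>) \<le> r"
proof (rule AE_distrD[where P = "\<lambda>z. cmod z \<le> r"])
  show "X \<in> measurable M lborel" using assms by (rule distributed_measurable)
  show "AE z in distr M lborel X. cmod z \<le> r"
    unfolding distributed_distr_eq_density[OF assms]
    by (subst AE_density[OF distributed_borel_measurable[OF assms]])
      (auto simp: disc_density_def indicator_def)
qed

text \<open>The event says that \<open>X\<close> lies in a disc of area \<open>pi * t\<close>, on
  which the density is between \<open>exp (-t) / pi\<close> and \<open>1 / pi\<close>. The squared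
  modulus is in fact exponential with mean 1, but these bounds already give the linear order in
  \<open>t\<close>.\<close>

lemma (in prob_space) cn_norm_square_prob_bounds:
  assumes X: "distributed M lborel X (\<lambda>z. ennreal (cn_density 1 z))" and "t \<ge> 0"
  shows "prob {\<omega> \<in> space M. (cmod (X \<omega>))\<^sup>2 \<le> t} \<le> t"
    and "t * exp (-t) \<le> prob {\<omega> \<in> space M. (cmod (X \<omega>))\<^sup>2 \<le> t}"
proof -
  define B where "B = cball (0::complex) (sqrt t)"
  have B_iff: "z \<in> B \<longleftrightarrow> (cmod z)\<^sup>2 \<le> t" for z
    using real_sqrt_le_iff[of "(cmod z)\<^sup>2" t] by (simp add: B_def)
  have set_eq: "{\<omega> \<in> space M. (cmod (X \<omega>))\<^sup>2 \<le> t} = X -` B \<inter> space M"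
    by (auto simp: B_iff)
  have area: "emeasure lborel B = ennreal (pi * t)"
    using \<open>t \<ge> 0\<close> by (simp add: B_def emeasure_cball unit_ball_vol_2)
  have [measurable]: "B \<in> sets borel" by (simp add: B_def)
  have prob_eq: "emeasure M (X -` B \<inter> space M) =
      (\<integral>\<^sup>+z. ennreal (cn_density 1 z) * indicator B z \<partial>lborel)"
    by (rule distributed_emeasure[OF X]) simp
  also have "\<dots> \<le> (\<integral>\<^sup>+z. ennreal (1 / pi) * indicator B z \<partial>lborel)"
    by (intro nn_integral_mono mult_right_mono ennreal_leI)
      (auto simp: cn_density_def divide_right_mono)
  also have "\<dots> = ennreal (1 / pi) * ennreal (pi * t)"
    by (simp add: nn_integral_cmult_indicator area)
  also have "\<dots> = ennreal t" using \<open>t \<ge> 0\<close> by (simp add: ennreal_mult[symmetric])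
  finally show "prob {\<omega> \<in> space M. (cmod (X \<omega>))\<^sup>2 \<le> t} \<le> t"
    using \<open>t \<ge> 0\<close> by (simp add: set_eq emeasure_eq_measure)
  have "ennreal (t * exp (-t)) = ennreal (exp (-t) / pi) * ennreal (pi * t)"
    using \<open>t \<ge> 0\<close> by (simp add: ennreal_mult[symmetric])
  also have "\<dots> = (\<integral>\<^sup>+z. ennreal (exp (-t) / pi) * indicator B z \<partial>lborel)"
    by (simp add: nn_integral_cmult_indicator area)
  also have "\<dots> \<le> (\<integral>\<^sup>+z. ennreal (cn_density 1 z) * indicator B z \<partial>lborel)"
    by (intro nn_integral_mono)
      (auto simp: cn_density_def B_iff indicator_def intro!: ennreal_leI divide_right_mono)
  finally show "t * exp (-t) \<le> prob {\<omega> \<in> space M. (cmod (X \<omega>))\<^sup>2 \<le> t}"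
    by (simp add: prob_eq[symmetric] set_eq emeasure_eq_measure)
qed

section \<open>Counting events for independent variables\<close>

text \<open>Writing a counting event as a finite union over \<open>k\<close>-element subsets gives
  both its measurability and a union bound.\<close>

lemma le_card_Collect_iff:
  assumes "finite I"
  shows "k \<le> card {i \<in> I. P i} \<longleftrightarrow> (\<exists>S\<subseteq>I. card S = k \<and> (\<forall>i\<in>S. P i))"
proof
  assume "k \<le> card {i \<in> I. P i}"
  then obtain S where "S \<subseteq> {i \<in> I. P i}" "card S = k"
    by (rule obtain_subset_with_card_n)
  then show "\<exists>S\<subseteq>I. card S = k \<and> (\<forall>i\<in>S. P i)" by blast
next
  assume "\<exists>S\<subseteq>I. card S = k \<and> (\<forall>i\<in>S. P i)"
  then show "k \<le> card {i \<in> I. P i}"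
    using assms by (auto intro!: card_mono)
qed

context prob_space
begin

lemma prob_INT_le_eq_prod:
  fixes V :: "'i \<Rightarrow> 'a \<Rightarrow> real"
  assumes "indep_vars (\<lambda>_. borel) V I" "S \<subseteq> I" "finite S" "S \<noteq> {}"
  shows "prob {\<omega> \<in> space M. \<forall>i\<in>S. V i \<omega> \<le> t} = (\<Prod>i\<in>S. prob {\<omega> \<in> space M. V i \<omega> \<le> t})"
proof -
  have "prob (\<Inter>i\<in>S. V i -` {..t} \<inter> space M) = (\<Prod>i\<in>S. prob (V i -` {..t} \<inter> space M))"
    using assms by (intro indep_varsD) auto
  moreover have "(\<Inter>i\<in>S. V i -` {..t} \<inter> space M) = {\<omega> \<in> space M. \<forall>i\<in>S. V i \<omega> \<le> t}"
    using \<open>S \<noteq> {}\<close> by auto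
  moreover have "V i -` {..t} \<inter> space M = {\<omega> \<in> space M. V i \<omega> \<le> t}" for i by auto
  ultimately show ?thesis by simp
qed

lemma sets_Collect_le_card:
  fixes V :: "'i \<Rightarrow> 'a \<Rightarrow> real"
  assumes "finite I" "\<And>i. i \<in> I \<Longrightarrow> V i \<in> borel_measurable M"
  shows "{\<omega> \<in> space M. k \<le> card {i \<in> I. V i \<omega> \<le> t}} \<in> events"
proof -
  have "{\<omega> \<in> space M. k \<le> card {i \<in> I. V i \<omega> \<le> t}} =
      (\<Union>S\<in>{S. S \<subseteq> I \<and> card S = k}. {\<omega> \<in> space M. \<forall>i\<in>S. V i \<omega> \<le> t})"
    using assms(1) by (auto simp: le_card_Collect_iff)
  also have "\<dots> \<in> events"
  proof (rule sets.finite_UN)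
    fix S assume "S \<in> {S. S \<subseteq> I \<and> card S = k}"
    then have "S \<subseteq> I" "finite S" using assms(1) finite_subset by auto
    then show "{\<omega> \<in> space M. \<forall>i\<in>S. V i \<omega> \<le> t} \<in> events"
      using assms(2) by (intro sets.sets_Collect_finite_All' sets.sets_Collect_finite_All borel_measurable_le) auto
  qed (use assms(1) in auto)
  finally show ?thesis .
qed

text \<open>Union bound over the \<open>k\<close>-element subsets of \<open>I\<close>: by
  independence each contributes at most \<open>q ^ k\<close>.\<close>

lemma prob_le_card_upper:
  fixes V :: "'i \<Rightarrow> 'a \<Rightarrow> real"
  assumes indep: "indep_vars (\<lambda>_. borel) V I" and "finite I" "k \<ge> 1"
    and q: "\<And>i. i \<in> I \<Longrightarrow> prob {\<omega> \<in> space M. V i \<omega> \<le> t} \<le> q"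
  shows "prob {\<omega> \<in> space M. k \<le> card {i \<in> I. V i \<omega> \<le> t}} \<le> real (card I choose k) * q ^ k"
proof -
  let ?F = "{S. S \<subseteq> I \<and> card S = k}"
  have V: "V i \<in> borel_measurable M" if "i \<in> I" for i
    using indep that by (auto simp: indep_vars_def)
  have S: "finite S" "S \<noteq> {}" "S \<subseteq> I" "card S = k" if "S \<in> ?F" for S
    using that assms(2,3) finite_subset by auto
  have "{\<omega> \<in> space M. k \<le> card {i \<in> I. V i \<omega> \<le> t}} =
      (\<Union>S\<in>?F. {\<omega> \<in> space M. \<forall>i\<in>S. V i \<omega> \<le> t})"
    using assms(2) by (auto simp: le_card_Collect_iff)
  also have "prob \<dots> \<le> (\<Sum>S\<in>?F. prob {\<omega> \<in> space M. \<forall>i\<in>S. V i \<omega> \<le> t})"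
  proof (rule measure_UNION_le)
    fix S assume "S \<in> ?F"
    note S = S[OF this]
    then show "{\<omega> \<in> space M. \<forall>i\<in>S. V i \<omega> \<le> t} \<in> events"
      using V by (intro sets.sets_Collect_finite_All borel_measurable_le) auto
  qed (use assms(2) in auto)
  also have "\<dots> \<le> (\<Sum>S\<in>?F. q ^ k)"
  proof (rule sum_mono)
    fix S assume "S \<in> ?F"
    note S = S[OF this]
    have "(\<Prod>i\<in>S. prob {\<omega> \<in> space M. V i \<omega> \<le> t}) \<le> (\<Prod>i\<in>S. q)"
      using S q by (intro prod_mono) auto
    then show "prob {\<omega> \<in> space M. \<forall>i\<in>S. V i \<omega> \<le> t} \<le> q ^ k"
      using S by (simp add: prob_INT_le_eq_prod[OF indep])
  qed
  also have "\<dots> = real (card I choose k) * q ^ k"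
    using n_subsets[OF assms(2), of k] by simp
  finally show ?thesis .
qed

text \<open>A single fixed \<open>k\<close>-element subset already forces the count, and by
  independence all its members are small with probability at least \<open>q ^ k\<close>.\<close>

lemma prob_le_card_lower:
  fixes V :: "'i \<Rightarrow> 'a \<Rightarrow> real"
  assumes indep: "indep_vars (\<lambda>_. borel) V I" and "finite I" "1 \<le> k" "k \<le> card I" "q \<ge> 0"
    and q: "\<And>i. i \<in> I \<Longrightarrow> q \<le> prob {\<omega> \<in> space M. V i \<omega> \<le> t}"
  shows "q ^ k \<le> prob {\<omega> \<in> space M. k \<le> card {i \<in> I. V i \<omega> \<le> t}}"
proof -
  obtain S where S: "S \<subseteq> I" "card S = k" "finite S"
    using obtain_subset_with_card_n[OF \<open>k \<le> card I\<close>] by metis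
  then have "S \<noteq> {}" using \<open>1 \<le> k\<close> by auto
  have V: "V i \<in> borel_measurable M" if "i \<in> I" for i
    using indep that by (auto simp: indep_vars_def)
  have "q ^ k = (\<Prod>i\<in>S. q)" using S by simp
  also have "\<dots> \<le> (\<Prod>i\<in>S. prob {\<omega> \<in> space M. V i \<omega> \<le> t})"
    using S q \<open>q \<ge> 0\<close> by (intro prod_mono) auto
  also have "\<dots> = prob {\<omega> \<in> space M. \<forall>i\<in>S. V i \<omega> \<le> t}"
    using S \<open>S \<noteq> {}\<close> by (simp add: prob_INT_le_eq_prod[OF indep])
  also have "\<dots> \<le> prob {\<omega> \<in> space M. k \<le> card {i \<in> I. V i \<omega> \<le> t}}"
    using S V assms(2) by (intro finite_measure_mono sets_Collect_le_card) (auto simp: le_card_Collect_iff)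
  finally show ?thesis .
qed

lemma indep_vars_reindex:
  assumes "inj_on f I" "indep_vars M' X (f ` I)"
  shows "indep_vars (\<lambda>i. M' (f i)) (\<lambda>i. X (f i)) I"
  unfolding indep_vars_def2 indep_sets_def
proof (intro conjI ballI allI impI)
  fix J A
  assume J: "J \<subseteq> I" "J \<noteq> {}" "finite J"
    and A: "A \<in> (\<Pi> j\<in>J. {X (f j) -` B \<inter> space M |B. B \<in> sets (M' (f j))})"
  let ?A = "\<lambda>i. A (inv_into J f i)"
  have inv: "inv_into J f (f j) = j" if "j \<in> J" for j
    using that inj_on_subset[OF assms(1) J(1)] by (rule inv_into_f_f[rotated])
  have "prob (\<Inter>i\<in>f ` J. ?A i) = (\<Prod>i\<in>f ` J. prob (?A i))"
  proof (rule indep_setsD)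
    show "indep_sets (\<lambda>i. {X i -` B \<inter> space M |B. B \<in> sets (M' i)}) (f ` I)"
      using assms(2) by (simp add: indep_vars_def2)
    show "\<forall>i\<in>f ` J. ?A i \<in> {X i -` B \<inter> space M |B. B \<in> sets (M' i)}"
      using A by (auto simp: inv)
  qed (use J in auto)
  then show "prob (\<Inter>j\<in>J. A j) = (\<Prod>j\<in>J. prob (A j))"
    using inj_on_subset[OF assms(1) J(1)] by (simp add: prod.reindex inv)
qed (use assms(2) in \<open>auto simp: indep_vars_def2 indep_sets_def\<close>)

end

theorem mainTheorem8:
  fixes W :: "'w measure"
    and M m n :: nat
    and \<eta> \<alpha> R_D \<Omega>_I :: real
    and a R :: "nat \<Rightarrow> real"
    and loc h :: "nat \<Rightarrow> 'w \<Rightarrow> complex"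
    and h_I :: "'w \<Rightarrow> complex"
  assumes "prob_space W"
    and "M \<ge> 2" and "1 \<le> m" and "m < n" and "n \<le> M"
    and "\<eta> > 0" and "\<alpha> > 0" and "R_D > 0" and "\<Omega>_I > 0"
    and "a m > a n" and "a n > 0" and "a m + a n = 1"
    and "R m > 0" and "R n > 0"
    and "\<And>i. i \<in> {1..M} \<Longrightarrow> distributed W lborel (loc i) (\<lambda>z. ennreal (disc_density R_D z))"
    and "\<And>i. i \<in> {1..M} \<Longrightarrow> distributed W lborel (h i) (\<lambda>z. ennreal (cn_density 1 z))"
    and "distributed W lborel h_I (\<lambda>z. ennreal (cn_density \<Omega>_I z))"
    and "prob_space.indep_vars W (\<lambda>_. borel)
           (\<lambda>s. case s of Location i \<Rightarrow> loc i | Fading i \<Rightarrow> h i | Residual \<Rightarrow> h_I)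
           (Location ` {1..M} \<union> Fading ` {1..M} \<union> {Residual})"
    and "a m > sinr_threshold (R m) * a n"
    and "a n > sinr_threshold (R n) * a m"
  shows "let P_n2 = (\<lambda>varpi. outage_ALF W (ordered_gain \<eta> \<alpha> M loc h n) (\<lambda>\<omega>. (cmod (h_I \<omega>))\<^sup>2)
                       varpi (a m) (a n) (sinr_threshold (R m)) (sinr_threshold (R n)))
         in has_diversity_order (P_n2 1) 0 \<and> has_diversity_order (P_n2 0) (real n)"
proof -

  \<comment> \<open>Constants of the model and comparison of gains with fadings\<close>
  interpret prob_space W by fact
  define \<epsilon>m where "\<epsilon>m = sinr_threshold (R m)"
  define \<epsilon>n where "\<epsilon>n = sinr_threshold (R n)"
  define Z where "Z = ordered_gain \<eta> \<alpha> M loc h n"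
  define g where "g i \<omega> = gain \<eta> \<alpha> (loc i \<omega>) (h i \<omega>)" for i \<omega>
  define V where "V i \<omega> = (cmod (h i \<omega>))\<^sup>2" for i \<omega>
  define Y where "Y \<omega> = (cmod (h_I \<omega>))\<^sup>2" for \<omega>
  \<comment> \<open>\<open>L\<close> bounds the path loss denominator on the disc. Below,
    \<open>\<mu>\<close> and \<open>\<nu>\<close> are the coefficients of the gain in the two
    linearised conditions, positive by the power allocation assumptions.\<close>
  define L where "L = 1 + R_D powr \<alpha>"
  define \<mu> where "\<mu> = a m - \<epsilon>m * a n"
  define \<nu> where "\<nu> = a n - \<epsilon>n * a m"
  let ?src = "\<lambda>s. case s of Location i \<Rightarrow> loc i | Fading i \<Rightarrow> h i | Residual \<Rightarrow> h_I"
  have pos: "\<eta> > 0" "\<alpha> > 0" "R_D > 0" "\<Omega>_I > 0" "a n > 0" "a m > 0" "n \<ge> 1"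
    using assms by auto
  have "\<epsilon>m > 0" "\<epsilon>n > 0"
    using \<open>R m > 0\<close> \<open>R n > 0\<close> by (auto simp: \<epsilon>m_def \<epsilon>n_def sinr_threshold_def)
  have "\<mu> > 0" "\<nu> > 0"
    using assms by (auto simp: \<mu>_def \<nu>_def \<epsilon>m_def \<epsilon>n_def)
  have "L > 0" by (simp add: L_def add_pos_nonneg)
  have distr_loc: "distributed W lborel (loc i) (\<lambda>z. ennreal (disc_density R_D z))"
    and distr_h: "distributed W lborel (h i) (\<lambda>z. ennreal (cn_density 1 z))"
    if "i \<in> {1..M}" for i
    using that assms by blast+
  have distr_I: "distributed W lborel h_I (\<lambda>z. ennreal (cn_density \<Omega>_I z))" by fact
  have indep: "indep_vars (\<lambda>_. borel) ?src (Location ` {1..M} \<union> Fading ` {1..M} \<union> {Residual})"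
    by fact
  have meas_loc[measurable]: "loc i \<in> borel_measurable W"
    and meas_h[measurable]: "h i \<in> borel_measurable W" if "i \<in> {1..M}" for i
    using distributed_measurable[OF distr_loc[OF that]] distributed_measurable[OF distr_h[OF that]]
    by simp_all
  have [measurable]: "h_I \<in> borel_measurable W"
    using distributed_measurable[OF distr_I] by simp
  have [measurable]: "Y \<in> borel_measurable W" unfolding Y_def by measurable
  have meas_g: "g i \<in> borel_measurable W" if [simp]: "i \<in> {1..M}" for i
    unfolding g_def channel_def by measurable (use that in auto)
  have Z_le_iff: "Z \<omega> \<le> x \<longleftrightarrow> n \<le> card {i \<in> {1..M}. g i \<omega> \<le> x}" for \<omega> x
    unfolding Z_def g_def using \<open>n \<ge> 1\<close> \<open>n \<le> M\<close> by (rule ordered_gain_le_iff)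
  have Z_in: "\<exists>i\<in>{1..M}. Z \<omega> = g i \<omega>" for \<omega>
    unfolding Z_def g_def using \<open>n \<ge> 1\<close> \<open>n \<le> M\<close> by (rule ordered_gain_in_range)
  then have Z_nonneg: "Z \<omega> \<ge> 0" for \<omega>
    by (metis g_def zero_le_power2)
  \<comment> \<open>Sublevel sets of \<open>Z\<close> are counting events, so sorting never has to
    be shown measurable.\<close>
  have [measurable]: "Z \<in> borel_measurable W"
    unfolding borel_measurable_iff_le Z_le_iff
    by (intro allI sets_Collect_le_card meas_g) auto
  have g_le: "g i \<omega> \<le> \<eta> * V i \<omega>" for i \<omega>
    unfolding g_def V_def using pos by (intro gain_le) auto
  \<comment> \<open>Only almost sure, because a density confines the locations to the disc only up
    to a null set.\<close>
  have AE_g_ge: "AE \<omega> in W. \<forall>i\<in>{1..M}. \<eta> * V i \<omega> / L \<le> g i \<omega>"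
  proof (rule AE_finite_allI)
    fix i assume "i \<in> {1..M}"
    from distributed_disc_AE_le[OF distr_loc[OF this]]
    show "AE \<omega> in W. \<eta> * V i \<omega> / L \<le> g i \<omega>"
      unfolding g_def V_def L_def by eventually_elim (use pos in \<open>auto intro!: gain_ge\<close>)
  qed simp
  have indep_V: "indep_vars (\<lambda>_. borel) V {1..M}"
  proof -
    have "indep_vars (\<lambda>_. borel) ?src (Fading ` {1..M})"
      by (rule indep_vars_subset[OF indep]) auto
    then have "indep_vars (\<lambda>_. borel) (\<lambda>i. ?src (Fading i)) {1..M}"
      by (rule indep_vars_reindex[rotated]) (auto simp: inj_on_def)
    then have "indep_vars (\<lambda>_. borel) (\<lambda>i \<omega>. (cmod (?src (Fading i) \<omega>))\<^sup>2) {1..M}"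
      by (rule indep_vars_compose2) auto
    then show ?thesis by (simp add: V_def[abs_def])
  qed
  have meas_V: "V i \<in> borel_measurable W" if "i \<in> {1..M}" for i
    using indep_V that by (auto simp: indep_vars_def)

  \<comment> \<open>Distribution function of the ordered gain near zero\<close>
  have Z_upper: "prob {\<omega> \<in> space W. Z \<omega> \<le> x} \<le> real (M choose n) * (L * x / \<eta>) ^ n"
    if "x \<ge> 0" for x
  proof -
    \<comment> \<open>A gain at most \<open>x\<close> almost surely forces the fading power below
      \<open>L * x / \<eta>\<close>, so the count can be taken over the independent variables
      \<open>V i\<close>.\<close>
    have "prob {\<omega> \<in> space W. Z \<omega> \<le> x} \<le>
        prob {\<omega> \<in> space W. n \<le> card {i \<in> {1..M}. V i \<omega> \<le> L * x / \<eta>}}"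
    proof (rule finite_measure_mono_AE)
      show "AE \<omega> in W. \<omega> \<in> {\<omega> \<in> space W. Z \<omega> \<le> x} \<longrightarrow>
          \<omega> \<in> {\<omega> \<in> space W. n \<le> card {i \<in> {1..M}. V i \<omega> \<le> L * x / \<eta>}}"
        using AE_g_ge
      proof eventually_elim
        case (elim \<omega>)
        have "V i \<omega> \<le> L * x / \<eta>" if "i \<in> {1..M}" "g i \<omega> \<le> x" for i
        proof -
          have "\<eta> * V i \<omega> / L \<le> x" using elim that by force
          then show ?thesis using \<open>L > 0\<close> \<open>\<eta> > 0\<close> by (simp add: field_simps)
        qed
        then have "card {i \<in> {1..M}. g i \<omega> \<le> x} \<le> card {i \<in> {1..M}. V i \<omega> \<le> L * x / \<eta>}"
          by (intro card_mono) auto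
        then show ?case by (auto simp: Z_le_iff)
      qed
    qed (intro sets_Collect_le_card meas_V, auto)
    also have "\<dots> \<le> real (card {1..M} choose n) * (L * x / \<eta>) ^ n"
    proof (rule prob_le_card_upper[OF indep_V _ \<open>n \<ge> 1\<close>])
      fix i assume "i \<in> {1..M}"
      then show "prob {\<omega> \<in> space W. V i \<omega> \<le> L * x / \<eta>} \<le> L * x / \<eta>"
        unfolding V_def using \<open>L > 0\<close> \<open>\<eta> > 0\<close> \<open>x \<ge> 0\<close>
        by (intro cn_norm_square_prob_bounds(1) distr_h) auto
    qed simp
    finally show ?thesis by simp
  qed
  have Z_lower: "(x / \<eta> * exp (- (x / \<eta>))) ^ n \<le> prob {\<omega> \<in> space W. Z \<omega> \<le> x}"
    if "x \<ge> 0" for x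
  proof -
    have "(x / \<eta> * exp (- (x / \<eta>))) ^ n \<le>
        prob {\<omega> \<in> space W. n \<le> card {i \<in> {1..M}. V i \<omega> \<le> x / \<eta>}}"
    proof (rule prob_le_card_lower[OF indep_V _ \<open>n \<ge> 1\<close>])
      fix i assume "i \<in> {1..M}"
      then show "x / \<eta> * exp (- (x / \<eta>)) \<le> prob {\<omega> \<in> space W. V i \<omega> \<le> x / \<eta>}"
        unfolding V_def using \<open>\<eta> > 0\<close> \<open>x \<ge> 0\<close>
        by (intro cn_norm_square_prob_bounds(2) distr_h) auto
    qed (use \<open>n \<le> M\<close> \<open>x \<ge> 0\<close> \<open>\<eta> > 0\<close> in auto)
    also have "\<dots> \<le> prob {\<omega> \<in> space W. Z \<omega> \<le> x}"
    proof (rule finite_measure_mono)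
      have "g i \<omega> \<le> x" if "V i \<omega> \<le> x / \<eta>" for i \<omega>
        using g_le[of i \<omega>] that \<open>\<eta> > 0\<close> by (simp add: field_simps)
      then have "card {i \<in> {1..M}. V i \<omega> \<le> x / \<eta>} \<le> card {i \<in> {1..M}. g i \<omega> \<le> x}" for \<omega>
        by (intro card_mono) auto
      then show "{\<omega> \<in> space W. n \<le> card {i \<in> {1..M}. V i \<omega> \<le> x / \<eta>}} \<subseteq> {\<omega> \<in> space W. Z \<omega> \<le> x}"
        by (auto simp: Z_le_iff intro: order_trans)
    qed measurable
    finally show ?thesis .
  qed

  define A where "A \<rho> = {\<omega> \<in> space W. sinr_n_to_m (a m) (a n) \<rho> (Z \<omega>) \<le> \<epsilon>m \<and>
      sinr_n_to_n (a m) (a n) \<rho> (Z \<omega>) \<le> \<epsilon>n}" for \<rho>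
  define B where "B varpi \<rho> = {\<omega> \<in> space W. sinr_n_to_m (a m) (a n) \<rho> (Z \<omega>) > \<epsilon>m \<and>
      sinr_n varpi (a n) \<rho> (Z \<omega>) (Y \<omega>) \<le> \<epsilon>n}" for varpi \<rho>
  define P where "P varpi = outage_ALF W Z Y varpi (a m) (a n) \<epsilon>m \<epsilon>n" for varpi
  have P_eq: "P varpi \<rho> = prob (A \<rho>) + prob (B varpi \<rho>)" for varpi \<rho>
    by (simp add: P_def outage_ALF_def A_def B_def)
  have B_events: "B varpi \<rho> \<in> events" for varpi \<rho>
    unfolding B_def sinr_n_to_m_def sinr_n_def by measurable

  \<comment> \<open>Perfect SIC: order \<open>n\<close>\<close>
  have "has_diversity_order (P 0) (real n)"
  proof -
    \<comment> \<open>The first outage event asks for both linear conditions, hence the minimum.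
      \<open>\<kappa>\<close> is the bound on \<open>\<rho> * Z\<close> in the second event when
      there is no residual interference.\<close>
    define \<tau> where "\<tau> = min (\<epsilon>m / \<mu>) (\<epsilon>n / \<nu>)"
    define \<kappa> where "\<kappa> = \<epsilon>n / a n"
    have "\<tau> > 0" "\<kappa> > 0"
      using \<open>\<epsilon>m > 0\<close> \<open>\<epsilon>n > 0\<close> \<open>\<mu> > 0\<close> \<open>\<nu> > 0\<close> pos by (auto simp: \<tau>_def \<kappa>_def)
    have A_eq: "A \<rho> = {\<omega> \<in> space W. Z \<omega> \<le> \<tau> / \<rho>}" if "\<rho> > 0" for \<rho>
    proof -
      have "sinr_n_to_m (a m) (a n) \<rho> z \<le> \<epsilon>m \<and> sinr_n_to_n (a m) (a n) \<rho> z \<le> \<epsilon>n \<longleftrightarrow> z \<le> \<tau> / \<rho>"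
        if "z \<ge> 0" for z
      proof -
        have "sinr_n_to_m (a m) (a n) \<rho> z \<le> \<epsilon>m \<longleftrightarrow> \<rho> * z \<le> \<epsilon>m / \<mu>"
          using \<open>\<rho> > 0\<close> that pos \<open>\<mu> > 0\<close>
          by (simp add: sinr_n_to_m_le_iff pos_le_divide_eq \<mu>_def[symmetric])
        moreover have "sinr_n_to_n (a m) (a n) \<rho> z \<le> \<epsilon>n \<longleftrightarrow> \<rho> * z \<le> \<epsilon>n / \<nu>"
          using \<open>\<rho> > 0\<close> that pos \<open>\<nu> > 0\<close>
          by (simp add: sinr_n_to_n_le_iff pos_le_divide_eq \<nu>_def[symmetric])
        moreover have "z \<le> \<tau> / \<rho> \<longleftrightarrow> \<rho> * z \<le> \<tau>"
          using \<open>\<rho> > 0\<close> by (simp add: pos_le_divide_eq mult.commute)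
        ultimately show ?thesis by (auto simp: \<tau>_def)
      qed
      then show ?thesis using Z_nonneg by (auto simp: A_def)
    qed
    have B_subset: "B 0 \<rho> \<subseteq> {\<omega> \<in> space W. Z \<omega> \<le> \<kappa> / \<rho>}" if "\<rho> > 0" for \<rho>
      using that pos by (auto simp: B_def Y_def sinr_n_le_iff \<kappa>_def field_simps)
    have power_scale: "(x / \<rho>) ^ n = x ^ n * \<rho> powr (- real n)" if "\<rho> > 0" for x \<rho> :: real
      using that by (simp add: power_divide powr_minus powr_realpow field_simps)
    show ?thesis
    proof (rule has_diversity_orderI)
      show "(\<tau> / \<eta> * exp (- (\<tau> / \<eta>))) ^ n > 0" using \<open>\<tau> > 0\<close> \<open>\<eta> > 0\<close> by simp
      show "\<forall>\<^sub>F \<rho> in at_top. (\<tau> / \<eta> * exp (- (\<tau> / \<eta>))) ^ n * \<rho> powr (- real n) \<le> P 0 \<rho>"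
        using eventually_ge_at_top[of 1]
      proof eventually_elim
        case (elim \<rho>)
        have "\<tau> / \<rho> / \<eta> \<le> \<tau> / \<eta>"
          using elim \<open>\<tau> > 0\<close> \<open>\<eta> > 0\<close> by (intro divide_right_mono) (auto simp: divide_le_eq)
        \<comment> \<open>For \<open>\<rho> \<ge> 1\<close> the exponential factor is at least its
          value at \<open>\<rho> = 1\<close>, so a constant free of \<open>\<rho>\<close> can be
          split off.\<close>
        then have "\<tau> / \<eta> * exp (- (\<tau> / \<eta>)) / \<rho> \<le> \<tau> / \<rho> / \<eta> * exp (- (\<tau> / \<rho> / \<eta>))"
          using elim \<open>\<tau> > 0\<close> \<open>\<eta> > 0\<close> by (simp add: divide_simps mult_left_mono)
        then have "(\<tau> / \<eta> * exp (- (\<tau> / \<eta>)) / \<rho>) ^ n \<le> (\<tau> / \<rho> / \<eta> * exp (- (\<tau> / \<rho> / \<eta>))) ^ n"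
          using elim \<open>\<tau> > 0\<close> \<open>\<eta> > 0\<close> by (intro power_mono) auto
        also have "\<dots> \<le> prob (A \<rho>)"
          using elim \<open>\<tau> > 0\<close> Z_lower[of "\<tau> / \<rho>"] by (simp only: A_eq) simp
        also have "\<dots> \<le> P 0 \<rho>" by (simp add: P_eq)
        finally show ?case using elim by (subst power_scale[symmetric]) simp_all
      qed
      show "\<forall>\<^sub>F \<rho> in at_top.
          P 0 \<rho> \<le> real (M choose n) * ((L * \<tau> / \<eta>) ^ n + (L * \<kappa> / \<eta>) ^ n) * \<rho> powr (- real n)"
        using eventually_gt_at_top[of 0]
      proof eventually_elim
        case (elim \<rho>)
        have bound: "prob {\<omega> \<in> space W. Z \<omega> \<le> x / \<rho>} \<le>
            real (M choose n) * (L * x / \<eta>) ^ n * \<rho> powr (- real n)" if "x > 0" for x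
        proof -
          have "L * (x / \<rho>) / \<eta> = L * x / \<eta> / \<rho>" by simp
          then have "(L * (x / \<rho>) / \<eta>) ^ n = (L * x / \<eta>) ^ n * \<rho> powr (- real n)"
            using power_scale[OF elim, of "L * x / \<eta>"] by (simp only:)
          then show ?thesis
            using Z_upper[of "x / \<rho>"] that elim by (simp add: mult.assoc)
        qed
        have "prob (B 0 \<rho>) \<le> prob {\<omega> \<in> space W. Z \<omega> \<le> \<kappa> / \<rho>}"
          using B_subset[OF elim] by (intro finite_measure_mono) measurable
        with bound[OF \<open>\<tau> > 0\<close>] bound[OF \<open>\<kappa> > 0\<close>] show ?case
          by (simp add: P_eq A_eq[OF elim] algebra_simps)
      qed
    qed
  qed

  \<comment> \<open>Imperfect SIC: order zero\<close>
  moreover have "has_diversity_order (P 1) 0"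
  proof -
    \<comment> \<open>Fadings in the annulus keep every gain between \<open>\<eta> / (4 * L)\<close>
      and \<open>\<eta>\<close> almost surely, while the residual interference gain exceeds
      \<open>\<eta> * a n / \<epsilon>n\<close>. The default branch is meant for
      \<open>Fading\<close>; \<open>J\<close> contains no \<open>Location\<close>.\<close>
    define U where "U s = (case s of
        Residual \<Rightarrow> {z. cmod z > sqrt (\<eta> * a n / \<epsilon>n)}
      | _ \<Rightarrow> ball 0 1 - cball 0 (1/2))" for s :: source
    define J where "J = insert Residual (Fading ` {1..M})"
    define E where "E = (\<Inter>s\<in>J. ?src s -` U s \<inter> space W)"
    have U_open: "open (U s)" for s
      by (auto simp: U_def split: source.split intro!: open_Collect_less continuous_intros)
    have U_nonempty: "U s \<noteq> {}" for s
    proof -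
      have "complex_of_real (3/4) \<in> ball 0 1 - cball 0 (1/2)" by simp
      moreover have "complex_of_real (sqrt (\<eta> * a n / \<epsilon>n) + 1) \<in>
          {z. cmod z > sqrt (\<eta> * a n / \<epsilon>n)}"
        using pos \<open>\<epsilon>n > 0\<close> by (auto simp del: of_real_add)
      ultimately show ?thesis unfolding U_def by (cases s) (simp_all only: source.case, blast+)
    qed
    have E_prod: "prob E = (\<Prod>s\<in>J. prob (?src s -` U s \<inter> space W))"
      unfolding E_def
      by (rule indep_varsD[OF indep]) (use U_open in \<open>auto simp: J_def\<close>)
    have E_pos: "prob E > 0"
      unfolding E_prod
    proof (rule prod_pos)
      fix s assume "s \<in> J"
      then show "prob (?src s -` U s \<inter> space W) > 0"
        using distributed_prob_open_pos[OF distr_h U_open U_nonempty]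
          distributed_prob_open_pos[OF distr_I U_open U_nonempty] \<open>\<Omega>_I > 0\<close>
        by (auto simp: J_def cn_density_pos)
    qed
    \<comment> \<open>Neither inequality mentions \<open>\<rho>\<close>: the first makes decoding of
      user \<open>m\<close> succeed once \<open>\<rho>\<close> is large, the second makes user
      \<open>n\<close> fail at every positive \<open>\<rho>\<close>.\<close>
    have AE_E: "AE \<omega> in W. \<omega> \<in> E \<longrightarrow> \<eta> / (4 * L) \<le> Z \<omega> \<and> Z \<omega> * a n \<le> \<epsilon>n * Y \<omega>"
      using AE_g_ge
    proof eventually_elim
      case (elim \<omega>)
      show ?case
      proof
        assume "\<omega> \<in> E"
        obtain i where i: "i \<in> {1..M}" "Z \<omega> = g i \<omega>" using Z_in by blast
        have "h i \<omega> \<in> U (Fading i)" "h_I \<omega> \<in> U Residual"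
          using \<open>\<omega> \<in> E\<close> i(1) by (auto simp: E_def J_def)
        then have hi: "1/2 < cmod (h i \<omega>)" "cmod (h i \<omega>) < 1"
          and hI: "sqrt (\<eta> * a n / \<epsilon>n) < cmod (h_I \<omega>)"
          by (auto simp: U_def)
        have V: "1/4 \<le> V i \<omega>" "V i \<omega> \<le> 1"
          using power_mono[of "1/2" "cmod (h i \<omega>)" 2] power_mono[of "cmod (h i \<omega>)" 1 2] hi
          by (auto simp: V_def power2_eq_square)
        have "\<eta> * a n / \<epsilon>n < Y \<omega>"
          using hI unfolding Y_def
          by (metis real_sqrt_less_iff real_sqrt_abs abs_norm_cancel)
        then have "\<eta> * a n \<le> \<epsilon>n * Y \<omega>" using \<open>\<epsilon>n > 0\<close> by (simp add: field_simps)
        moreover have "Z \<omega> \<le> \<eta>"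
          using g_le[of i \<omega>] mult_left_mono[OF V(2), of \<eta>] \<open>\<eta> > 0\<close> i(2) by linarith
        then have "Z \<omega> * a n \<le> \<eta> * a n" using pos by (intro mult_right_mono) auto
        moreover have "\<eta> * (1/4) / L \<le> \<eta> * V i \<omega> / L"
          using V \<open>\<eta> > 0\<close> \<open>L > 0\<close> by (intro divide_right_mono mult_left_mono) auto
        then have "\<eta> / (4 * L) \<le> Z \<omega>" using elim i by fastforce
        ultimately show "\<eta> / (4 * L) \<le> Z \<omega> \<and> Z \<omega> * a n \<le> \<epsilon>n * Y \<omega>" by linarith
      qed
    qed
    show ?thesis
    proof (rule has_diversity_orderI[OF E_pos])
      show "\<forall>\<^sub>F \<rho> in at_top. prob E * \<rho> powr (-0) \<le> P 1 \<rho>"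
        \<comment> \<open>Beyond this value the smallest gain allowed on \<open>E\<close> satisfies
          \<open>\<rho> * (\<eta> / (4 * L)) * \<mu> > \<epsilon>m\<close>.\<close>
        using eventually_gt_at_top[of 0] eventually_gt_at_top[of "4 * L * \<epsilon>m / (\<mu> * \<eta>)"]
      proof eventually_elim
        case (elim \<rho>)
        have "prob E \<le> prob (B 1 \<rho>)"
        proof (rule finite_measure_mono_AE[OF _ B_events])
          show "AE \<omega> in W. \<omega> \<in> E \<longrightarrow> \<omega> \<in> B 1 \<rho>"
            using AE_E
          proof eventually_elim
            case (elim \<omega>)
            show ?case
            proof
              assume "\<omega> \<in> E"
              then have Z: "\<eta> / (4 * L) \<le> Z \<omega>" "Z \<omega> * a n \<le> \<epsilon>n * Y \<omega>" and "\<omega> \<in> space W"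
                using elim by (auto simp: E_def J_def)
              have "\<epsilon>m < \<rho> * (\<eta> / (4 * L)) * \<mu>"
                using \<open>4 * L * \<epsilon>m / (\<mu> * \<eta>) < \<rho>\<close> \<open>\<mu> > 0\<close> \<open>\<eta> > 0\<close> \<open>L > 0\<close>
                by (simp add: field_simps)
              also have "\<dots> \<le> \<rho> * Z \<omega> * \<mu>"
                using Z \<open>\<mu> > 0\<close> \<open>\<rho> > 0\<close> by (intro mult_right_mono mult_left_mono) auto
              finally have "\<not> sinr_n_to_m (a m) (a n) \<rho> (Z \<omega>) \<le> \<epsilon>m"
                using pos \<open>\<rho> > 0\<close> Z_nonneg by (simp add: sinr_n_to_m_le_iff \<mu>_def)
              moreover have "\<rho> * (Z \<omega> * a n) \<le> \<rho> * (\<epsilon>n * Y \<omega>)"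
                using Z \<open>\<rho> > 0\<close> by (intro mult_left_mono) auto
              \<comment> \<open>Signal and interference scale alike in \<open>\<rho>\<close>; the
                noise term only adds \<open>\<epsilon>n > 0\<close> on the right.\<close>
              then have "\<rho> * Z \<omega> * a n \<le> \<epsilon>n * (1 * \<rho> * Y \<omega> + 1)"
                using \<open>\<epsilon>n > 0\<close> by (simp add: algebra_simps)
              then have "sinr_n 1 (a n) \<rho> (Z \<omega>) (Y \<omega>) \<le> \<epsilon>n"
                using \<open>\<rho> > 0\<close> by (subst sinr_n_le_iff) (auto simp: Y_def)
              ultimately show "\<omega> \<in> B 1 \<rho>" using \<open>\<omega> \<in> space W\<close> by (simp add: B_def)
            qed
          qed
        qed
        also have "\<dots> \<le> P 1 \<rho>" by (simp add: P_eq)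
        finally show ?case using elim by simp
      qed
      show "\<forall>\<^sub>F \<rho> in at_top. P 1 \<rho> \<le> 2 * \<rho> powr (-0)"
        using eventually_gt_at_top[of 0]
      proof eventually_elim
        case (elim \<rho>)
        have "P 1 \<rho> \<le> 2"
          unfolding P_eq using prob_le_1[of "A \<rho>"] prob_le_1[of "B 1 \<rho>"] by linarith
        with elim show ?case by simp
      qed
    qed
  qed
  ultimately show ?thesis
    by (simp add: Let_def P_def[abs_def] Z_def Y_def[abs_def] \<epsilon>m_def \<epsilon>n_def)
qed

end
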